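(* Let $n\in\mathbb{N}$ and let $\alpha,\beta\ge e$. Then: (1) $v_\alpha^{(2)}\sim v_\beta^{(2)}\sim v_\beta^{(1)}$ on $\mathbb{B}_n$; that is, there is a constant $K>0$ such that for all $z\in\mathbb{B}_n$, $\frac1K v_\alpha^{(2)}(z)\le v_\beta^{(2)}(z)\le K v_\alpha^{(2)}(z)$ and $\frac1K v_\beta^{(2)}(z)\le v_\beta^{(1)}(z)\le K v_\beta^{(2)}(z)$. (2) $\mathcal{B}^{\log}_{2,\alpha}(\mathbb{B}_n)=\mathcal{B}^{\log}_{2,\beta}(\mathbb{B}_n)=\mathcal{B}^{\log}_{1,\beta}(\mathbb{B}_n)$ as sets. (3) $\|f\|_{2,\alpha}\sim\|f\|_{2,\beta}\sim\|f\|_{1,\beta}$ as $f$ varies through these coinciding spaces; that is, there is a constant $K'>0$ such that for all $f$ in this common space, $\frac1{K'}\|f\|_{2,\alpha}\le\|f\|_{2,\beta}\le K'\|f\|_{2,\alpha}$ and $\frac1{K'}\|f\|_{2,\beta}\le\|f\|_{1,\beta}\le K'\|f\|_{2,\beta}$.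
   Context: $\mathbb{B}_n$ is the open Euclidean unit ball of $\mathbb{C}^n$, $|\cdot|$ is the Euclidean norm, and $\log$ is the natural logarithm. For $\theta>1$ and $k\in\{1,2\}$, $v_\theta^{(k)}(z):=(1-|z|^k)\log\frac{\theta}{1-|z|^k}$ for $z\in\mathbb{B}_n$. For a continuous positive function $\mu$ on $\mathbb{B}_n$, $\mathcal{B}^\mu(\mathbb{B}_n)$ is the space of holomorphic functions $f$ on $\mathbb{B}_n$ such that $b_\mu^f:=\sup_{z\in\mathbb{B}_n}\mu(z)|(\nabla f)(z)|<\infty$, where $\nabla f=(\partial f/\partial z_1,\dots,\partial f/\partial z_n)$, with norm $\|f\|_{\mathcal{B}^\mu(\mathbb{B}_n)}:=|f(0)|+b_\mu^f$. The $(k,\theta)$-log Bloch space is $\mathcal{B}^{\log}_{k,\theta}(\mathbb{B}_n):=\mathcal{B}^{\mu}(\mathbb{B}_n)$ with $\mu=v_\theta^{(k)}$, and its norm is denoted $\|f\|_{k,\theta}$. *)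

theory Defs
  imports "HOL-Analysis.Analysis"
begin

text \<open>
  The space \<open>\<complex>\<^sup>n\<close> is \<^typ>\<open>complex ^ 'n\<close>, whose library norm is the Euclidean norm, so
  the open unit ball is \<open>ball 0 1\<close>. As with the library's \<open>holomorphic_on\<close>, functions are total
  and their values outside the set in question are irrelevant.
\<close>

text \<open>
  Complex differentiability in several variables: the Frechet derivative is additive and
  real-homogeneous by \<open>has_derivative\<close>, so complex homogeneity makes it complex-linear.
\<close>

definition holomorphic_vec_on :: "(complex ^ 'n \<Rightarrow> complex) \<Rightarrow> (complex ^ 'n) set \<Rightarrow> bool"
    (infix "holomorphic'_vec'_on" 50) where
  "f holomorphic_vec_on S \<longleftrightarrow>
    (\<forall>z\<in>S. \<exists>D. (f has_derivative D) (at z within S) \<and> (\<forall>c x. D (c *s x) = c * D x))"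

definition complex_grad :: "(complex ^ 'n \<Rightarrow> complex) \<Rightarrow> complex ^ 'n \<Rightarrow> complex ^ 'n" where
  "complex_grad f z = (\<chi> j. deriv (\<lambda>w. f (z + axis j w)) 0)"

definition log_weight :: "nat \<Rightarrow> real \<Rightarrow> complex ^ 'n \<Rightarrow> real" where
  "log_weight k \<theta> z = (1 - norm z ^ k) * ln (\<theta> / (1 - norm z ^ k))"

definition bloch_space :: "(complex ^ 'n \<Rightarrow> real) \<Rightarrow> (complex ^ 'n \<Rightarrow> complex) set" where
  "bloch_space \<mu> =
    {f. f holomorphic_vec_on ball 0 1 \<and>
        bdd_above ((\<lambda>z. \<mu> z * norm (complex_grad f z)) ` ball 0 1)}"

text \<open>
  The supremum is a real one, hence meaningful only for members of \<open>bloch_space \<mu>\<close>.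
\<close>

definition bloch_seminorm :: "(complex ^ 'n \<Rightarrow> real) \<Rightarrow> (complex ^ 'n \<Rightarrow> complex) \<Rightarrow> real" where
  "bloch_seminorm \<mu> f = (SUP z\<in>ball 0 1. \<mu> z * norm (complex_grad f z))"

definition bloch_norm :: "(complex ^ 'n \<Rightarrow> real) \<Rightarrow> (complex ^ 'n \<Rightarrow> complex) \<Rightarrow> real" where
  "bloch_norm \<mu> f = norm (f 0) + bloch_seminorm \<mu> f"

definition log_bloch_space :: "nat \<Rightarrow> real \<Rightarrow> (complex ^ 'n \<Rightarrow> complex) set" where
  "log_bloch_space k \<theta> = bloch_space (log_weight k \<theta>)"

definition log_bloch_norm :: "nat \<Rightarrow> real \<Rightarrow> (complex ^ 'n \<Rightarrow> complex) \<Rightarrow> real" where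
  "log_bloch_norm k \<theta> = bloch_norm (log_weight k \<theta>)"

end

theory Submission
  imports Defs
begin

text \<open>
  With \<open>t = 1 - \<bar>z\<bar>\<^sup>k \<in> (0, 1]\<close> every weight is a value of the profile \<open>t ln (\<theta> / t)\<close>, so the
  comparison of weights is a statement about one real variable. Passing from \<open>\<alpha>\<close> to \<open>\<beta>\<close> only adds
  a constant to the logarithm; since \<open>ln \<alpha>\<close> and \<open>ln \<beta>\<close> are at least 1, this costs at most the
  factor \<open>ln \<beta>\<close> (lemma \<open>log_profile_change_base\<close>). Passing from \<open>k = 1\<close> to \<open>k = 2\<close> replaces \<open>t\<close> by
  \<open>(1 - \<bar>z\<bar>) (1 + \<bar>z\<bar>)\<close>, which lies between \<open>t\<close> and \<open>2 t\<close>; for \<open>\<theta> \<ge> e\<close> the profile increases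
  on \<open>(0, 1]\<close> and at most doubles when its argument does (lemmas \<open>log_profile_mono\<close> and
  \<open>log_profile_le_double\<close>). All four comparisons therefore hold with the single constant
  \<open>2 ln \<alpha> ln \<beta> \<ge> 2\<close>.

  Finally, a pointwise bound \<open>\<nu> \<le> K \<mu>\<close> with \<open>K \<ge> 1\<close> transfers to Bloch spaces and norms
  (lemmas \<open>bloch_space_antimono\<close> and \<open>bloch_norm_le\<close>), because the gradient enters the
  definitions only through the products \<open>\<mu> z \<bar>\<nabla>f z\<bar>\<close>.
\<close>

text \<open>
  Writing \<open>s = - ln t \<ge> 0\<close>, the claim is \<open>ln \<beta> + s \<le> ln \<beta> (ln \<alpha> + s)\<close>, which holds termwise
  because \<open>ln \<alpha> \<ge> 1\<close> and \<open>ln \<beta> \<ge> 1\<close>.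
\<close>

lemma log_profile_change_base:
  fixes \<alpha> \<beta> t :: real
  assumes "\<alpha> \<ge> exp 1" and "\<beta> \<ge> exp 1" and "0 < t" and "t \<le> 1"
  shows "t * ln (\<beta> / t) \<le> ln \<beta> * (t * ln (\<alpha> / t))"
proof -
  have pos: "\<alpha> > 0" "\<beta> > 0"
    using assms(1,2) exp_gt_zero[of "1::real"] by linarith+
  have one: "ln \<alpha> \<ge> 1" "ln \<beta> \<ge> 1"
    using assms(1,2) pos by (simp_all add: ln_ge_iff)
  have "ln t \<le> 0"
    using assms(3,4) by simp
  then have "ln \<beta> * 1 + 1 * - ln t \<le> ln \<beta> * ln \<alpha> + ln \<beta> * - ln t"
    using one by (intro add_mono mult_left_mono mult_right_mono) auto
  then have "ln (\<beta> / t) \<le> ln \<beta> * ln (\<alpha> / t)"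
    using pos assms(3) by (simp add: ln_div algebra_simps)
  then have "t * ln (\<beta> / t) \<le> t * (ln \<beta> * ln (\<alpha> / t))"
    using assms(3) by (intro mult_left_mono) auto
  then show ?thesis
    by (simp add: mult.left_commute)
qed

lemma ln_div_ge_one:
  fixes \<theta> t :: real
  assumes "\<theta> \<ge> exp 1" and "0 < t" and "t \<le> 1"
  shows "ln (\<theta> / t) \<ge> 1"
proof -
  have pos: "\<theta> > 0"
    using assms(1) exp_gt_zero[of "1::real"] by linarith
  have "ln \<theta> \<ge> 1" "ln t \<le> 0"
    using assms pos by (simp_all add: ln_ge_iff)
  moreover have "ln (\<theta> / t) = ln \<theta> - ln t"
    using pos assms(2) by (simp add: ln_div)
  ultimately show ?thesis
    by linarith
qed

text \<open>
  The tangent bound \<open>ln (u / t) \<le> u / t - 1\<close> shows that shrinking \<open>u\<close> to \<open>t\<close> raises the term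
  \<open>t ln (\<theta> / \<sqdot>)\<close> by at most \<open>u - t\<close>, and \<open>(u - t) ln (\<theta> / u)\<close> makes up for this because
  \<open>ln (\<theta> / u) \<ge> 1\<close>.
\<close>

lemma log_profile_mono:
  fixes \<theta> t u :: real
  assumes "\<theta> \<ge> exp 1" and "0 < t" and "t \<le> u" and "u \<le> 1"
  shows "t * ln (\<theta> / t) \<le> u * ln (\<theta> / u)"
proof -
  have pos: "\<theta> > 0" "u > 0"
    using assms exp_gt_zero[of "1::real"] by linarith+
  have one: "ln (\<theta> / u) \<ge> 1"
    by (rule ln_div_ge_one) (use assms pos in auto)
  have "ln (u / t) \<le> u / t - 1"
    using pos assms(2) by (intro ln_le_minus_one) simp
  then have "t * ln (u / t) \<le> t * (u / t - 1)"
    using assms(2) by (intro mult_left_mono) auto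
  also have "\<dots> = (u - t) * 1"
    using assms(2) by (simp add: field_simps)
  also have "\<dots> \<le> (u - t) * ln (\<theta> / u)"
    using one assms(3) by (intro mult_left_mono) auto
  finally have "t * ln (u / t) \<le> (u - t) * ln (\<theta> / u)" .
  moreover have "ln (\<theta> / t) = ln (\<theta> / u) + ln (u / t)"
    using pos assms(2) by (simp add: ln_div)
  ultimately show ?thesis
    by (simp add: algebra_simps)
qed

lemma log_profile_le_double:
  fixes \<theta> t u :: real
  assumes "\<theta> \<ge> exp 1" and "0 < t" and "t \<le> u" and "u \<le> 1" and "u \<le> 2 * t"
  shows "u * ln (\<theta> / u) \<le> 2 * (t * ln (\<theta> / t))"
proof -
  have pos: "\<theta> > 0" "u > 0"
    using assms exp_gt_zero[of "1::real"] by linarith+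
  have "ln (\<theta> / u) \<le> ln (\<theta> / t)"
    using pos assms(2,3) by (simp add: ln_div)
  moreover have "ln (\<theta> / u) \<ge> 1"
    by (rule ln_div_ge_one) (use assms pos in auto)
  ultimately have "u * ln (\<theta> / u) \<le> (2 * t) * ln (\<theta> / t)"
    using assms(2,5) by (intro mult_mono) auto
  then show ?thesis
    by simp
qed

lemma norm_power_ball_bounds:
  fixes z :: "complex ^ 'n"
  assumes "z \<in> ball 0 1" and "k > 0"
  shows "0 < 1 - norm z ^ k" and "1 - norm z ^ k \<le> 1"
  using assms by (auto simp: power_less_one_iff)

lemma log_weight_nonneg:
  fixes z :: "complex ^ 'n"
  assumes "\<theta> \<ge> exp 1" and "k > 0" and "z \<in> ball 0 1"
  shows "log_weight k \<theta> z \<ge> 0"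
  using norm_power_ball_bounds[OF assms(3,2)]
    ln_div_ge_one[OF assms(1) norm_power_ball_bounds[OF assms(3,2)]]
  by (simp only: log_weight_def) (intro mult_nonneg_nonneg; linarith)

lemma log_weight_change_base:
  fixes z :: "complex ^ 'n"
  assumes "\<alpha> \<ge> exp 1" and "\<beta> \<ge> exp 1" and "k > 0" and "z \<in> ball 0 1"
  shows "log_weight k \<beta> z \<le> ln \<beta> * log_weight k \<alpha> z"
  unfolding log_weight_def
  using log_profile_change_base[OF assms(1,2) norm_power_ball_bounds[OF assms(4,3)]] .

lemma log_weight_change_exponent:
  fixes z :: "complex ^ 'n"
  assumes "\<theta> \<ge> exp 1" and "z \<in> ball 0 1"
  shows "log_weight 1 \<theta> z \<le> log_weight 2 \<theta> z"
    and "log_weight 2 \<theta> z \<le> 2 * log_weight 1 \<theta> z"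
proof -
  let ?r = "norm z"
  have r: "?r < 1"
    using assms(2) by simp
  have "?r ^ 2 \<le> ?r"
    using r by (simp add: power2_eq_square mult_left_le)
  then have le: "1 - ?r \<le> 1 - ?r ^ 2"
    by simp
  have "0 \<le> (1 - ?r) ^ 2"
    by simp
  then have double: "1 - ?r ^ 2 \<le> 2 * (1 - ?r)"
    by (simp add: power2_eq_square algebra_simps)
  show "log_weight 1 \<theta> z \<le> log_weight 2 \<theta> z"
    using log_profile_mono[OF assms(1) _ le] r by (simp add: log_weight_def)
  show "log_weight 2 \<theta> z \<le> 2 * log_weight 1 \<theta> z"
    using log_profile_le_double[OF assms(1) _ le _ double] r by (simp add: log_weight_def)
qed

lemma weighted_grad_le_seminorm:
  fixes f :: "complex ^ 'n \<Rightarrow> complex"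
  assumes "f \<in> bloch_space \<mu>" and "z \<in> ball 0 1"
  shows "\<mu> z * norm (complex_grad f z) \<le> bloch_seminorm \<mu> f"
  unfolding bloch_seminorm_def
  using assms by (intro cSUP_upper) (auto simp: bloch_space_def)

lemma weighted_grad_le_mult_seminorm:
  fixes f :: "complex ^ 'n \<Rightarrow> complex"
  assumes "K \<ge> 0" and "\<nu> z \<le> K * \<mu> z" and "f \<in> bloch_space \<mu>" and "z \<in> ball 0 1"
  shows "\<nu> z * norm (complex_grad f z) \<le> K * bloch_seminorm \<mu> f"
proof -
  have "\<nu> z * norm (complex_grad f z) \<le> K * (\<mu> z * norm (complex_grad f z))"
    using mult_right_mono[OF assms(2) norm_ge_zero] by (simp add: mult.assoc)
  also have "\<dots> \<le> K * bloch_seminorm \<mu> f"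
    using weighted_grad_le_seminorm[OF assms(3,4)] assms(1) by (rule mult_left_mono)
  finally show ?thesis .
qed

lemma bloch_space_antimono:
  fixes \<mu> \<nu> :: "complex ^ 'n \<Rightarrow> real"
  assumes "K \<ge> 0" and "\<And>z. z \<in> ball 0 1 \<Longrightarrow> \<nu> z \<le> K * \<mu> z"
  shows "bloch_space \<mu> \<subseteq> bloch_space \<nu>"
proof
  fix f :: "complex ^ 'n \<Rightarrow> complex"
  assume f: "f \<in> bloch_space \<mu>"
  have "bdd_above ((\<lambda>z. \<nu> z * norm (complex_grad f z)) ` ball 0 1)"
    using assms f
    by (intro bdd_aboveI2[of _ _ "K * bloch_seminorm \<mu> f"] weighted_grad_le_mult_seminorm) auto
  then show "f \<in> bloch_space \<nu>"
    using f by (simp add: bloch_space_def)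
qed

text \<open>
  Requiring \<open>K \<ge> 1\<close> lets the same constant absorb the unweighted summand \<open>\<bar>f 0\<bar>\<close> of the norm.
\<close>

lemma bloch_norm_le:
  fixes \<mu> \<nu> :: "complex ^ 'n \<Rightarrow> real"
  assumes "K \<ge> 1" and "\<And>z. z \<in> ball 0 1 \<Longrightarrow> \<nu> z \<le> K * \<mu> z" and "f \<in> bloch_space \<mu>"
  shows "bloch_norm \<nu> f \<le> K * bloch_norm \<mu> f"
proof -
  have "bloch_seminorm \<nu> f \<le> K * bloch_seminorm \<mu> f"
    unfolding bloch_seminorm_def[of \<nu>]
    using assms by (intro cSUP_least weighted_grad_le_mult_seminorm) auto
  moreover have "norm (f 0) \<le> K * norm (f 0)"
    using mult_right_mono[OF assms(1) norm_ge_zero] by simp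
  ultimately show ?thesis
    by (simp add: bloch_norm_def distrib_left)
qed

theorem theorem6p2:
  fixes \<alpha> \<beta> :: real
  assumes "\<alpha> \<ge> exp 1" and "\<beta> \<ge> exp 1"
  shows
    "(\<exists>K>0. \<forall>z \<in> ball (0 :: complex ^ 'n) 1.
        1 / K * log_weight 2 \<alpha> z \<le> log_weight 2 \<beta> z \<and>
        log_weight 2 \<beta> z \<le> K * log_weight 2 \<alpha> z \<and>
        1 / K * log_weight 2 \<beta> z \<le> log_weight 1 \<beta> z \<and>
        log_weight 1 \<beta> z \<le> K * log_weight 2 \<beta> z)
     \<and> (log_bloch_space 2 \<alpha> :: (complex ^ 'n \<Rightarrow> complex) set) = log_bloch_space 2 \<beta>
     \<and> (log_bloch_space 2 \<beta> :: (complex ^ 'n \<Rightarrow> complex) set) = log_bloch_space 1 \<beta>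
     \<and> (\<exists>K'>0. \<forall>f \<in> (log_bloch_space 2 \<alpha> :: (complex ^ 'n \<Rightarrow> complex) set).
        1 / K' * log_bloch_norm 2 \<alpha> f \<le> log_bloch_norm 2 \<beta> f \<and>
        log_bloch_norm 2 \<beta> f \<le> K' * log_bloch_norm 2 \<alpha> f \<and>
        1 / K' * log_bloch_norm 2 \<beta> f \<le> log_bloch_norm 1 \<beta> f \<and>
        log_bloch_norm 1 \<beta> f \<le> K' * log_bloch_norm 2 \<beta> f)"
proof -
  define K where "K = 2 * (ln \<alpha> * ln \<beta>)"
  have "\<alpha> > 0" "\<beta> > 0"
    using assms exp_gt_zero[of "1::real"] by linarith+
  then have ln: "ln \<alpha> \<ge> 1" "ln \<beta> \<ge> 1"
    using assms by (simp_all add: ln_ge_iff)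
  have prod: "ln \<alpha> \<le> ln \<alpha> * ln \<beta>" "ln \<beta> \<le> ln \<alpha> * ln \<beta>"
    using mult_left_mono[of 1 "ln \<beta>" "ln \<alpha>"] mult_right_mono[of 1 "ln \<alpha>" "ln \<beta>"] ln by auto
  have K: "1 \<le> K" "2 \<le> K" "ln \<alpha> \<le> K" "ln \<beta> \<le> K"
    using ln prod unfolding K_def by linarith+
  have enlarge: "x \<le> K * y" if "x \<le> c * y" "c \<le> K" "0 \<le> y" for x y c
    using that(1) mult_right_mono[OF that(2,3)] by (rule order_trans)
  have div: "1 / K * x \<le> y \<longleftrightarrow> x \<le> K * y" for x y
    using K(1) by (simp add: field_simps)
  have \<alpha>\<beta>: "log_weight 2 \<alpha> z \<le> K * log_weight 2 \<beta> z"
    and \<beta>\<alpha>: "log_weight 2 \<beta> z \<le> K * log_weight 2 \<alpha> z"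
    and b21: "log_weight 2 \<beta> z \<le> K * log_weight 1 \<beta> z"
    and b12: "log_weight 1 \<beta> z \<le> K * log_weight 2 \<beta> z"
    if z: "z \<in> ball 0 1" for z :: "complex ^ 'n"
  proof -
    show "log_weight 2 \<alpha> z \<le> K * log_weight 2 \<beta> z"
      using log_weight_change_base[OF assms(2,1) _ z] log_weight_nonneg[OF assms(2) _ z] K(3)
      by (intro enlarge[of _ "ln \<alpha>"]) auto
    show "log_weight 2 \<beta> z \<le> K * log_weight 2 \<alpha> z"
      using log_weight_change_base[OF assms(1,2) _ z] log_weight_nonneg[OF assms(1) _ z] K(4)
      by (intro enlarge[of _ "ln \<beta>"]) auto
    show "log_weight 2 \<beta> z \<le> K * log_weight 1 \<beta> z"
      using log_weight_change_exponent(2)[OF assms(2) z] K(2)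
        log_weight_nonneg[OF assms(2) zero_less_one z]
      by (rule enlarge)
    show "log_weight 1 \<beta> z \<le> K * log_weight 2 \<beta> z"
      using log_weight_change_exponent(1)[OF assms(2) z] log_weight_nonneg[OF assms(2) _ z] K(1)
      by (intro enlarge[of _ 1]) auto
  qed
  have K0: "K \<ge> 0" "K > 0"
    using K(1) by linarith+
  have eq\<alpha>\<beta>: "(log_bloch_space 2 \<alpha> :: (complex ^ 'n \<Rightarrow> complex) set) = log_bloch_space 2 \<beta>"
    unfolding log_bloch_space_def
    using bloch_space_antimono[OF K0(1) \<beta>\<alpha>] bloch_space_antimono[OF K0(1) \<alpha>\<beta>]
    by (rule equalityI)
  have eq21: "(log_bloch_space 2 \<beta> :: (complex ^ 'n \<Rightarrow> complex) set) = log_bloch_space 1 \<beta>"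
    unfolding log_bloch_space_def
    using bloch_space_antimono[OF K0(1) b12] bloch_space_antimono[OF K0(1) b21]
    by (rule equalityI)
  have norms: "log_bloch_norm 2 \<alpha> f \<le> K * log_bloch_norm 2 \<beta> f \<and>
      log_bloch_norm 2 \<beta> f \<le> K * log_bloch_norm 2 \<alpha> f \<and>
      log_bloch_norm 2 \<beta> f \<le> K * log_bloch_norm 1 \<beta> f \<and>
      log_bloch_norm 1 \<beta> f \<le> K * log_bloch_norm 2 \<beta> f"
    if f: "f \<in> log_bloch_space 2 \<alpha>" for f :: "complex ^ 'n \<Rightarrow> complex"
  proof -
    have mem: "f \<in> bloch_space (log_weight 2 \<alpha>)" "f \<in> bloch_space (log_weight 2 \<beta>)"
      "f \<in> bloch_space (log_weight 1 \<beta>)"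
      using f eq\<alpha>\<beta> eq21 by (auto simp: log_bloch_space_def)
    show ?thesis
      unfolding log_bloch_norm_def
      using bloch_norm_le[OF K(1) \<alpha>\<beta> mem(2)] bloch_norm_le[OF K(1) \<beta>\<alpha> mem(1)]
        bloch_norm_le[OF K(1) b21 mem(3)] bloch_norm_le[OF K(1) b12 mem(2)]
      by blast
  qed
  show ?thesis
  proof (intro conjI eq\<alpha>\<beta> eq21)
  qed (use K0(2) \<alpha>\<beta> \<beta>\<alpha> b21 b12 norms in \<open>intro exI[of _ K]; auto simp only: div\<close>)+
qed

end
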